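(* Let $F$ be a real cubic homogeneous polynomial in three variables such that $\inf_{z\in\mathbb{R}}\operatorname{Re}[K_F(z)]\ge 0$. Then exactly one of the following three conditions is satisfied: (i) $\operatorname{Re}[K_F(z)]=0$ for all $z\in\mathbb{R}$; (ii) there exists a constant $C_3>0$ such that $\operatorname{Re}[K_F(z)]\ge \dfrac{C_3}{\cosh^3 z}$ for all $z\in\mathbb{R}$; (iii) there exists $z_0\in\mathbb{R}$ such that $\operatorname{Re}[K_F(z_0)]=0$ and $\operatorname{Re}[K_F(z)]>0$ for all $z\in\mathbb{R}\setminus\{z_0\}$.
   Context: For a real cubic homogeneous polynomial $F$ in three variables define $K_F:\mathbb{R}\to\mathbb{C}$ by $$K_F(z)=\frac{i}{2\pi}\int_0^{2\pi}F(\cos\theta,\,-\cosh z\,\sin\theta,\,\sinh z\,\sin\theta)\,e^{-i\theta}\,d\theta .$$ *)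

theory Defs
  imports "HOL-Analysis.Analysis"
begin

text \<open>
  Polynomials in three variables are represented by the functions they induce on the reals
  (faithful, since the field is infinite). The zero polynomial counts as homogeneous of degree 3.
\<close>

definition cubic_form :: "(real \<Rightarrow> real \<Rightarrow> real \<Rightarrow> real) \<Rightarrow> bool" where
  "cubic_form F \<longleftrightarrow>
     (\<exists>a :: nat \<Rightarrow> nat \<Rightarrow> nat \<Rightarrow> real. \<forall>x y z.
        F x y z = (\<Sum>(i, j, k) \<in> {(i, j, k). i + j + k = 3}. a i j k * x ^ i * y ^ j * z ^ k))"

lemma finite_cubic_exponents: "finite {(i, j, k). i + j + k = (3::nat)}"
  by (rule finite_subset[of _ "{..3} \<times> {..3} \<times> {..3}"]) auto

definition K :: "(real \<Rightarrow> real \<Rightarrow> real \<Rightarrow> real) \<Rightarrow> real \<Rightarrow> complex" where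
  "K F z = \<i> / (2 * complex_of_real pi) *
     integral {0..2 * pi}
       (\<lambda>\<theta>. complex_of_real (F (cos \<theta>) (- cosh z * sin \<theta>) (sinh z * sin \<theta>))
             * exp (- \<i> * complex_of_real \<theta>))"

definition exactly_one_of_three :: "bool \<Rightarrow> bool \<Rightarrow> bool \<Rightarrow> bool" where
  "exactly_one_of_three P Q R \<longleftrightarrow>
     (P \<and> \<not> Q \<and> \<not> R) \<or> (\<not> P \<and> Q \<and> \<not> R) \<or> (\<not> P \<and> \<not> Q \<and> R)"

end

theory Submission
  imports Defs
begin

text \<open>
  Expanding \<open>F\<close> and integrating, only the monomials of odd total degree in the last two variables
  contribute to \<open>Re (K F z)\<close>, which becomes a cubic plus a linear form in \<open>cosh z\<close>, \<open>sinh z\<close>.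
  With \<open>v = exp (2 * z)\<close> this reads \<open>Re (K F z) = exp (-3 * z) * q v\<close> for a polynomial \<open>q\<close> of
  degree at most 3 that is nonnegative on the positive half-line. A zero \<open>v > 0\<close> of \<open>q\<close> is a double
  zero, so two distinct ones force \<open>q = 0\<close>. If there is none, then \<open>q\<close> is bounded below by a positive
  constant on \<open>v \<ge> 1\<close> and, by reversing its coefficients, by a multiple of \<open>v ^ 3\<close> on \<open>v \<le> 1\<close>.
\<close>

section \<open>The real part of \<open>K F\<close> as a cubic in \<open>exp z ^ 2\<close>\<close>

lemma cubic_exponents_eq:
  "{(i, j, k). i + j + k = (3::nat)} =
    {(3,0,0), (2,1,0), (2,0,1), (1,2,0), (1,1,1), (1,0,2), (0,3,0), (0,2,1), (0,1,2), (0,0,3)}"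
proof (intro set_eqI, clarify)
  fix i j k :: nat
  have "i = 0 \<or> i = 1 \<or> i = 2 \<or> i = 3 \<or> i > 3" "j = 0 \<or> j = 1 \<or> j = 2 \<or> j = 3 \<or> j > 3"
    by linarith+
  then show "(i, j, k) \<in> {(i, j, k). i + j + k = 3} \<longleftrightarrow> (i, j, k) \<in>
      {(3,0,0), (2,1,0), (2,0,1), (1,2,0), (1,1,1), (1,0,2), (0,3,0), (0,2,1), (0,1,2), (0,0,3)}"
    by (elim disjE) auto
qed

text \<open>An explicit antiderivative \<open>G\<close> suffices: its trigonometric terms have
  period \<open>2 * pi\<close>, so only the linear terms \<open>t / 8\<close> and
  \<open>3 * t / 8\<close> survive between the endpoints. They carry \<open>f1\<close> and
  \<open>f3\<close>, whence the weights 1 and 3.\<close>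

lemma integral_trig_cubic_sin:
  fixes f0 f1 f2 f3 :: real
  shows "((\<lambda>t. (f0 * cos t ^ 3 + f1 * (cos t ^ 2 * sin t) + f2 * (cos t * sin t ^ 2) + f3 * sin t ^ 3)
      * sin t) has_integral pi / 4 * (f1 + 3 * f3)) {0..2 * pi}"
proof -
  define G :: "real \<Rightarrow> real" where
    "G t = f0 * (- (cos t ^ 4) / 4) + f1 * (t / 8 - sin t * cos t * (cos t ^ 2 - sin t ^ 2) / 8)
      + f2 * (sin t ^ 4 / 4) + f3 * (3 * t / 8 - 3 / 8 * (sin t * cos t) - sin t ^ 3 * cos t / 4)" for t
  have "(G has_real_derivative
      (f0 * cos t ^ 3 + f1 * (cos t ^ 2 * sin t) + f2 * (cos t * sin t ^ 2) + f3 * sin t ^ 3) * sin t) (at t)"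
    for t
  proof -
    \<comment> \<open>The derivatives in \<open>d1\<close> and \<open>d3\<close> match their stated
      form only modulo this identity.\<close>
    have c: "cos t ^ 2 = 1 - sin t ^ 2"
      using sin_cos_squared_add[of t] by linarith
    have d1: "((\<lambda>t. t / 8 - sin t * cos t * (cos t ^ 2 - sin t ^ 2) / 8) has_real_derivative
        cos t ^ 2 * sin t ^ 2) (at t)"
      apply (rule derivative_eq_intros refl | simp)+
      using c by algebra
    have d3: "((\<lambda>t. 3 * t / 8 - 3 / 8 * (sin t * cos t) - sin t ^ 3 * cos t / 4) has_real_derivative
        sin t ^ 4) (at t)"
      apply (rule derivative_eq_intros refl | simp)+
      using c by algebra
    have d0: "((\<lambda>t. - (cos t ^ 4) / 4) has_real_derivative cos t ^ 3 * sin t) (at t)"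
      by (rule derivative_eq_intros refl | simp)+
    have d2: "((\<lambda>t. sin t ^ 4 / 4) has_real_derivative cos t * sin t ^ 3) (at t)"
      by (rule derivative_eq_intros refl | simp)+
    show ?thesis
      unfolding G_def
      by (rule DERIV_cong[OF DERIV_add[OF DERIV_add[OF DERIV_add[OF
              DERIV_cmult[OF d0] DERIV_cmult[OF d1]] DERIV_cmult[OF d2]] DERIV_cmult[OF d3]]])
        (simp add: algebra_simps power2_eq_square power3_eq_cube power4_eq_xxxx)
  qed
  then have "((\<lambda>t. (f0 * cos t ^ 3 + f1 * (cos t ^ 2 * sin t) + f2 * (cos t * sin t ^ 2) + f3 * sin t ^ 3)
      * sin t) has_integral G (2 * pi) - G 0) {0..2 * pi}"
    by (intro fundamental_theorem_of_calculus)
      (auto simp: has_real_derivative_iff_has_vector_derivative[symmetric] intro: DERIV_subset)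
  moreover have "G (2 * pi) - G 0 = pi / 4 * (f1 + 3 * f3)"
    by (simp add: G_def algebra_simps)
  ultimately show ?thesis
    by simp
qed

text \<open>The factor \<open>\<i>\<close> turns the real part into minus an imaginary part, and
  \<open>exp (- \<i> * t)\<close> has imaginary part \<open>- sin t\<close>, so the two signs
  cancel. Continuity gives integrability, which lets \<open>Im\<close> pass under the
  integral.\<close>

lemma Re_K_eq_integral:
  assumes "continuous_on {0..2 * pi} (\<lambda>t. F (cos t) (- cosh z * sin t) (sinh z * sin t))"
  shows "Re (K F z) =
    integral {0..2 * pi} (\<lambda>t. F (cos t) (- cosh z * sin t) (sinh z * sin t) * sin t) / (2 * pi)"
proof -
  let ?f = "\<lambda>t. F (cos t) (- cosh z * sin t) (sinh z * sin t)"
  let ?h = "\<lambda>t. complex_of_real (?f t) * exp (- \<i> * complex_of_real t)"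
  have "?h integrable_on {0..2 * pi}"
    using assms by (intro integrable_continuous_interval continuous_intros)
  from has_integral_Im[OF integrable_integral[OF this]]
  have "((\<lambda>t. Im (?h t)) has_integral Im (integral {0..2 * pi} ?h)) {0..2 * pi}" .
  moreover have "Im (?h t) = - (?f t * sin t)" for t
    by (simp add: Im_exp)
  ultimately have "((\<lambda>t. - (?f t * sin t)) has_integral Im (integral {0..2 * pi} ?h)) {0..2 * pi}"
    by simp
  from integral_unique[OF this]
  have "Im (integral {0..2 * pi} ?h) = - integral {0..2 * pi} (\<lambda>t. ?f t * sin t)"
    unfolding integral_neg by (rule sym)
  moreover have "Re (\<i> / (2 * complex_of_real pi) * w) = - Im w / (2 * pi)" for w
    by (simp add: Re_divide Im_divide power2_eq_square)
  ultimately show ?thesis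
    by (simp add: K_def)
qed

text \<open>After the substitution, the coefficient of \<open>cos t ^ 2 * sin t\<close> is a linear
  form in \<open>cosh z\<close> and \<open>sinh z\<close>, and that of \<open>sin t ^ 3\<close> is a
  cubic form in them.\<close>

lemma Re_K_hyperbolic:
  assumes "cubic_form F"
  obtains p q A B C D where
    "\<And>z. Re (K F z) = p * cosh z + q * sinh z
      + A * cosh z ^ 3 + B * cosh z ^ 2 * sinh z + C * cosh z * sinh z ^ 2 + D * sinh z ^ 3"
proof -
  from assms obtain a where a: "\<And>x y z. F x y z =
      (\<Sum>(i, j, k) \<in> {(i, j, k). i + j + k = 3}. a i j k * x ^ i * y ^ j * z ^ k)"
    unfolding cubic_form_def by blast
  have "Re (K F z) = (- a 2 1 0 / 8) * cosh z + (a 2 0 1 / 8) * sinh z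
      + (- 3 * a 0 3 0 / 8) * cosh z ^ 3 + (3 * a 0 2 1 / 8) * cosh z ^ 2 * sinh z
      + (- 3 * a 0 1 2 / 8) * cosh z * sinh z ^ 2 + (3 * a 0 0 3 / 8) * sinh z ^ 3" for z
  proof -
    define c s where "c = cosh z" and "s = sinh z"
    define f0 f1 f2 f3 where "f0 = a 3 0 0" and "f1 = - a 2 1 0 * c + a 2 0 1 * s"
      and "f2 = a 1 2 0 * c ^ 2 - a 1 1 1 * c * s + a 1 0 2 * s ^ 2"
      and "f3 = - a 0 3 0 * c ^ 3 + a 0 2 1 * c ^ 2 * s - a 0 1 2 * c * s ^ 2 + a 0 0 3 * s ^ 3"
    have F: "F (cos t) (- cosh z * sin t) (sinh z * sin t) =
        f0 * cos t ^ 3 + f1 * (cos t ^ 2 * sin t) + f2 * (cos t * sin t ^ 2) + f3 * sin t ^ 3" for t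
      unfolding a cubic_exponents_eq c_def[symmetric] s_def[symmetric]
      by (simp add: f0_def f1_def f2_def f3_def algebra_simps power2_eq_square power3_eq_cube)
    have "Re (K F z) = pi / 4 * (f1 + 3 * f3) / (2 * pi)"
      by (subst Re_K_eq_integral)
        (simp_all only: F integral_unique[OF integral_trig_cubic_sin], intro continuous_intros)
    then have "Re (K F z) = (f1 + 3 * f3) / 8"
      by simp
    then show ?thesis
      by (simp add: f1_def f3_def c_def s_def field_simps)
  qed
  with that show thesis
    by blast
qed

lemma Re_K_exp_cubic:
  assumes "cubic_form F"
  obtains q where "degree q \<le> 3" "\<And>z. Re (K F z) * exp z ^ 3 = poly q (exp z ^ 2)"
proof -
  obtain p q A B C D where K: "\<And>z. Re (K F z) = p * cosh z + q * sinh z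
      + A * cosh z ^ 3 + B * cosh z ^ 2 * sinh z + C * cosh z * sinh z ^ 2 + D * sinh z ^ 3"
    using Re_K_hyperbolic[OF assms] by metis
  \<comment> \<open>With \<open>v = exp z ^ 2\<close>, both \<open>cosh z * exp z\<close> and
    \<open>sinh z * exp z\<close> become \<open>(v + 1) / 2\<close> and \<open>(v - 1) / 2\<close>.
    The linear terms keep a spare factor \<open>v\<close>, so \<open>p\<close> and \<open>q\<close>
    enter only the two middle coefficients.\<close>
  define Q where "Q = [:(A - B + C - D) / 8, (p - q) / 2 + (3 * A - B - C + 3 * D) / 8,
    (p + q) / 2 + (3 * A + B - C - 3 * D) / 8, (A + B + C + D) / 8:]"
  have "Re (K F z) * exp z ^ 3 = poly Q (exp z ^ 2)" for z
  proof -
    define u c s where "u = exp z" and "c = cosh z" and "s = sinh z"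
    have c: "c * u = (u ^ 2 + 1) / 2" and s: "s * u = (u ^ 2 - 1) / 2"
      unfolding u_def c_def s_def
      by (simp_all add: cosh_field_def sinh_field_def exp_minus field_simps power2_eq_square)
    have "Re (K F z) * u ^ 3 = (p * (c * u) + q * (s * u)) * u ^ 2
        + A * (c * u) ^ 3 + B * (c * u) ^ 2 * (s * u) + C * (c * u) * (s * u) ^ 2 + D * (s * u) ^ 3"
      unfolding K c_def[symmetric] s_def[symmetric]
      by (simp add: algebra_simps power2_eq_square power3_eq_cube)
    also have "\<dots> = poly Q (u ^ 2)"
      unfolding c s Q_def by (simp add: field_simps power2_eq_square power3_eq_cube)
    finally show ?thesis
      by (simp add: u_def)
  qed
  moreover have "degree Q \<le> 3"
    by (simp add: Q_def)
  ultimately show thesis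
    using that by blast
qed

section \<open>Lower bounds and multiple roots of real polynomials\<close>

lemma poly_pos_atLeast_bounded_below:
  fixes q :: "real poly"
  assumes pos: "\<And>x. x \<ge> a \<Longrightarrow> poly q x > 0"
  obtains C where "C > 0" "\<And>x. x \<ge> a \<Longrightarrow> poly q x \<ge> C"
proof -
  \<comment> \<open>Otherwise \<open>- q\<close> would be positive far out, against the
    hypothesis.\<close>
  have "lead_coeff q > 0"
  proof (rule ccontr)
    assume "\<not> lead_coeff q > 0"
    moreover have "q \<noteq> 0"
      using pos[of a] by auto
    ultimately have "lead_coeff (- q) > 0"
      by (metis leading_coeff_0_iff lead_coeff_minus linorder_neqE_linordered_idom neg_0_less_iff_less)
    from poly_pinfty_gt_lc[OF this] obtain n where "\<And>x. x \<ge> n \<Longrightarrow> poly (- q) x \<ge> lead_coeff (- q)"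
      by blast
    from this[of "max n a"] \<open>lead_coeff (- q) > 0\<close> pos[of "max n a"] show False
      by simp
  qed
  from poly_pinfty_gt_lc[OF this] obtain n where n: "\<And>x. x \<ge> n \<Longrightarrow> poly q x \<ge> lead_coeff q"
    by blast
  \<comment> \<open>The maximum with \<open>a\<close> keeps this compact interval nonempty even if
    \<open>n < a\<close>.\<close>
  have "\<exists>x\<in>{a..max n a}. \<forall>y\<in>{a..max n a}. poly q x \<le> poly q y"
    by (intro continuous_attains_inf continuous_on_poly continuous_on_id) auto
  then obtain m where m: "m \<in> {a..max n a}" "\<And>x. x \<in> {a..max n a} \<Longrightarrow> poly q m \<le> poly q x"
    by blast
  show thesis
  proof
    show "min (poly q m) (lead_coeff q) > 0"
      using pos m(1) \<open>lead_coeff q > 0\<close> by simp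
    show "min (poly q m) (lead_coeff q) \<le> poly q x" if "x \<ge> a" for x
      using that m(2)[of x] n[of x] by (cases "x \<le> n") (auto simp: min_le_iff_disj)
  qed
qed

text \<open>The comparison function is bounded by 1 and by \<open>x ^ 3\<close>, so each half of the
  half-line needs only one of these bounds. At \<open>x = exp z ^ 2\<close> the fraction is
  \<open>exp z / (2 * cosh z)\<close>.\<close>

lemma cubic_pos_bound:
  fixes q :: "real poly"
  assumes deg: "degree q \<le> 3" and pos: "\<And>x. x > 0 \<Longrightarrow> poly q x > 0"
  obtains C where "C > 0" "\<And>x. x > 0 \<Longrightarrow> poly q x \<ge> C * (x / (1 + x)) ^ 3"
proof -
  obtain C1 where C1: "C1 > 0" "\<And>x. x \<ge> 1 \<Longrightarrow> poly q x \<ge> C1"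
    using poly_pos_atLeast_bounded_below[of 1 q] pos by (metis less_le_trans zero_less_one)
  \<comment> \<open>\<open>reflect_poly\<close> reverses with respect to the actual degree; the
    monomial makes up the difference to 3.\<close>
  define r where "r = monom 1 (3 - degree q) * reflect_poly q"
  have r: "poly r x = x ^ 3 * poly q (inverse x)" if "x > 0" for x
    using that deg unfolding r_def
    by (simp add: poly_reflect_poly_nz poly_monom power_add[symmetric] flip: mult.assoc)
  have "poly r x > 0" if "x \<ge> 1" for x
    using that pos[of "inverse x"] by (simp add: r)
  then obtain C2 where C2: "C2 > 0" "\<And>x. x \<ge> 1 \<Longrightarrow> poly r x \<ge> C2"
    using poly_pos_atLeast_bounded_below[of 1 r] by metis
  show thesis
  proof
    show "min C1 C2 > 0"
      using C1 C2 by simp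
    show "min C1 C2 * (x / (1 + x)) ^ 3 \<le> poly q x" if x: "x > 0" for x
    proof (cases "x \<ge> 1")
      case True
      have "(x / (1 + x)) ^ 3 \<le> 1"
        using x by (intro power_le_one) auto
      then have "min C1 C2 * (x / (1 + x)) ^ 3 \<le> C1 * 1"
        using C1 x by (intro mult_mono) auto
      then show ?thesis
        using C1(2)[OF True] by simp
    next
      case False
      have "(x / (1 + x)) ^ 3 \<le> x ^ 3"
        using x by (intro power_mono) (auto simp: field_simps)
      then have "min C1 C2 * (x / (1 + x)) ^ 3 \<le> C2 * x ^ 3"
        using C2 x by (intro mult_mono) auto
      also have "C2 \<le> poly q x / x ^ 3"
        using C2(2)[of "inverse x"] False x by (simp add: r one_le_inverse field_simps)
      then have "C2 * x ^ 3 \<le> poly q x"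
        using x by (simp add: field_simps)
      finally show ?thesis .
    qed
  qed
qed

text \<open>The root is an interior local minimum, so the derivative vanishes there too.\<close>

lemma poly_nonneg_double_root:
  fixes q :: "real poly"
  assumes "q \<noteq> 0" "open S" "x \<in> S" "poly q x = 0" and nonneg: "\<And>y. y \<in> S \<Longrightarrow> poly q y \<ge> 0"
  shows "order x q \<ge> 2"
proof -
  obtain d where d: "d > 0" "ball x d \<subseteq> S"
    using assms openE by blast
  have "poly (pderiv q) x = 0"
  proof (rule DERIV_local_min[OF poly_DERIV d(1)], intro allI impI)
    fix y assume "\<bar>x - y\<bar> < d"
    then have "y \<in> S"
      using d by (auto simp: dist_real_def)
    then show "poly q x \<le> poly q y"
      using nonneg assms by simp
  qed
  then have "pderiv q = 0 \<or> order x (pderiv q) \<noteq> 0"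
    by (simp add: order_root)
  \<comment> \<open>A constant polynomial with a root would be zero.\<close>
  moreover have "pderiv q \<noteq> 0"
    using assms(1,4) by (metis degree_0_id degree_pCons_0 order_root order_degree pderiv_eq_0_iff le_zero_eq)
  ultimately show ?thesis
    using order_pderiv[OF assms(1,4)] by simp
qed

text \<open>Two distinct roots, each of order at least 2, would force degree at least 4.\<close>

lemma cubic_nonneg_two_roots_eq_0:
  fixes q :: "real poly"
  assumes "degree q \<le> 3" "open S" "x \<in> S" "y \<in> S" "x \<noteq> y" "poly q x = 0" "poly q y = 0"
    and "\<And>t. t \<in> S \<Longrightarrow> poly q t \<ge> 0"
  shows "q = 0"
proof (rule ccontr)
  assume q: "q \<noteq> 0"
  have "order x q \<ge> 2" "order y q \<ge> 2"
    using poly_nonneg_double_root[OF q assms(2)] assms by blast+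
  moreover from this obtain r where r: "q = [:- x, 1:] ^ 2 * r"
    by (metis order_divides dvdE)
  \<comment> \<open>Hence the whole multiplicity of \<open>y\<close> lies in the cofactor
    \<open>r\<close>.\<close>
  moreover have "order y ([:- x, 1:] ^ 2) = 0"
    using assms(5) by (intro order_0I) simp
  ultimately have "order y r \<ge> 2"
    using q order_mult[of "[:- x, 1:] ^ 2" r y] by simp
  moreover have "r \<noteq> 0"
    using q r by auto
  ultimately have "degree r \<ge> 2"
    using order_degree[of r y] by simp
  moreover have "degree q = 2 + degree r"
    unfolding r using \<open>r \<noteq> 0\<close> by (simp add: degree_mult_eq degree_power_eq)
  ultimately show False
    using assms(1) by simp
qed

section \<open>The trichotomy\<close>

theorem mainTheorem5:
  fixes F :: "real \<Rightarrow> real \<Rightarrow> real \<Rightarrow> real"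
  assumes "cubic_form F"
    and "(INF z. ereal (Re (K F z))) \<ge> 0"
  shows "exactly_one_of_three
    (\<forall>z. Re (K F z) = 0)
    (\<exists>C\<^sub>3 > 0. \<forall>z. Re (K F z) \<ge> C\<^sub>3 / cosh z ^ 3)
    (\<exists>z\<^sub>0. Re (K F z\<^sub>0) = 0 \<and> (\<forall>z \<in> UNIV - {z\<^sub>0}. Re (K F z) > 0))"
proof -
  define R where "R z = Re (K F z)" for z
  have nonneg: "R z \<ge> 0" for z
    using assms(2) by (simp add: le_INF_iff R_def)
  obtain q where deg: "degree q \<le> 3" and q: "\<And>z. R z * exp z ^ 3 = poly q (exp z ^ 2)"
    using Re_K_exp_cubic[OF assms(1)] unfolding R_def by metis
  \<comment> \<open>Surjectivity onto the positive half-line carries sign information from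
    \<open>R\<close> to \<open>q\<close>.\<close>
  have ex: "\<exists>z. v = exp z ^ 2" if "v > 0" for v :: real
    by (rule exI[of _ "ln v / 2"]) (use that in \<open>simp flip: exp_double\<close>)
  have q_nonneg: "poly q v \<ge> 0" if "v \<in> {0<..}" for v
    using ex[of v] that nonneg by (auto simp flip: q)
  have bound_pos: "R z > 0" if "C > 0" "\<forall>z. R z \<ge> C / cosh z ^ 3" for C z
  proof -
    have "C / cosh z ^ 3 > 0"
      using that by (simp add: cosh_real_pos)
    then show ?thesis
      using that less_le_trans by blast
  qed
  have bound: "\<exists>C>0. \<forall>z. R z \<ge> C / cosh z ^ 3" if pos: "\<And>z. R z > 0"
  proof -
    have "poly q v > 0" if "v > 0" for v
      using ex[of v] that pos by (auto simp flip: q)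
    then obtain C where C: "C > 0" "\<And>v. v > 0 \<Longrightarrow> poly q v \<ge> C * (v / (1 + v)) ^ 3"
      using cubic_pos_bound[OF deg] by metis
    \<comment> \<open>The 8 is the cube of the 2 in \<open>exp z / (2 * cosh z)\<close>.\<close>
    have "R z \<ge> C / 8 / cosh z ^ 3" for z
    proof -
      have "1 + exp z ^ 2 = exp z * (2 * cosh z)"
        by (simp add: cosh_field_def exp_minus field_simps power2_eq_square)
      then have "exp z ^ 2 / (1 + exp z ^ 2) = exp z / (2 * cosh z)"
        by (simp only:) (simp add: power2_eq_square)
      then have "C * (exp z / (2 * cosh z)) ^ 3 \<le> R z * exp z ^ 3"
        using C(2)[of "exp z ^ 2"] by (simp add: q)
      then have "(C / 8 / cosh z ^ 3) * exp z ^ 3 \<le> R z * exp z ^ 3"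
        by (simp add: power_divide power_mult_distrib)
      then show ?thesis
        by (rule mult_right_le_imp_le) simp
    qed
    then show ?thesis
      using C(1) by (intro exI[of _ "C / 8"]) simp
  qed
  have zero: "\<forall>z. R z = 0" if "R x = 0" "R y = 0" "x \<noteq> y" for x y
  proof -
    have "exp x ^ 2 \<noteq> exp y ^ 2"
      using that by (simp flip: exp_double)
    moreover have "poly q (exp x ^ 2) = 0" "poly q (exp y ^ 2) = 0"
      using that by (simp_all flip: q)
    ultimately have "q = 0"
      using cubic_nonneg_two_roots_eq_0[OF deg open_greaterThan[of 0], of "exp x ^ 2" "exp y ^ 2"] q_nonneg
      by simp
    then show ?thesis
      using q by simp
  qed
  have "exactly_one_of_three (\<forall>z. R z = 0) (\<exists>C>0. \<forall>z. R z \<ge> C / cosh z ^ 3)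
    (\<exists>z\<^sub>0. R z\<^sub>0 = 0 \<and> (\<forall>z \<in> UNIV - {z\<^sub>0}. R z > 0))"
  proof (cases "\<exists>z\<^sub>0. R z\<^sub>0 = 0")
    case False
    then have "R z > 0" for z
      using nonneg[of z] by (metis order_less_le)
    from bound[OF this] False show ?thesis
      unfolding exactly_one_of_three_def by blast
  next
    case True
    then obtain z\<^sub>0 where z\<^sub>0: "R z\<^sub>0 = 0"
      by blast
    then have no_bound: "\<not> (\<exists>C>0. \<forall>z. R z \<ge> C / cosh z ^ 3)"
      using bound_pos[of _ z\<^sub>0] by auto
    show ?thesis
    proof (cases "\<forall>z. R z = 0")
      case True
      \<comment> \<open>A second point excludes the third alternative: strict positivity would have
        to hold there.\<close>
      moreover have "\<exists>z :: real. z \<noteq> z\<^sub>1" for z\<^sub>1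
        by (rule exI[of _ "z\<^sub>1 + 1"]) simp
      ultimately show ?thesis
        using no_bound unfolding exactly_one_of_three_def by auto
    next
      case False
      then have "R z > 0" if "z \<noteq> z\<^sub>0" for z
        using zero[OF z\<^sub>0, of z] that nonneg[of z] by (auto simp: order_less_le)
      then show ?thesis
        using no_bound z\<^sub>0 False unfolding exactly_one_of_three_def by blast
    qed
  qed
  then show ?thesis
    unfolding R_def .
qed

end
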